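(* Let $\mathbf{M}\in\mathbb{R}^{d\times d}$ be a symmetric positive definite matrix, let $\alpha>0$, and let $\hat S\sim \mathrm{DPP}\left(\frac{1}{\alpha}\mathbf{M}\right)$. Then $$\mathbb{E}\big[(\mathbf{M}_{\hat S})^{+}\big] = (\alpha\mathbf{I}+\mathbf{M})^{-1}.$$
   Context: $[d]=\{1,\dots,d\}$ and $\mathbf{I}$ is the $d\times d$ identity matrix. For $S\subseteq[d]$, $\mathbf{M}_{SS}$ denotes the $|S|\times|S|$ principal submatrix of $\mathbf{M}$ with rows and columns indexed by $S$, and $\mathbf{M}_S$ denotes the $d\times d$ matrix whose $(i,j)$ entry equals $\mathbf{M}_{ij}$ if $i,j\in S$ and $0$ otherwise (so $\mathbf{M}_\emptyset=\mathbf{0}$). $(\cdot)^{+}$ is the Moore-Penrose pseudoinverse. For a $d\times d$ positive semidefinite matrix $\mathbf{A}$, $\mathrm{DPP}(\mathbf{A})$ is the probability distribution over all subsets $S\subseteq[d]$ (including $\emptyset$) with $\mathbb{P}(S)\propto\det(\mathbf{A}_{SS})$, with the convention $\det(\mathbf{A}_{\emptyset\emptyset})=1$. *)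

theory Defs
  imports
    "HOL-Probability.Probability_Mass_Function"
    "Jordan_Normal_Form.Gauss_Jordan_Elimination"
    "Jordan_Normal_Form.Char_Poly"
    "Jordan_Normal_Form.DL_Submatrix"
begin

text \<open>
  Matrices are those of \<^theory>\<open>Jordan_Normal_Form.Matrix\<close>, so the index set
  of a \<open>d\<close>-dimensional matrix is \<open>{..<d}\<close>, playing the role of \<open>{1,...,d}\<close>.
  The library inverse \<^const>\<open>mat_inverse\<close> is option-valued:
  \<open>mat_inverse A = Some B\<close> says that \<open>A\<close> is invertible with inverse \<open>B\<close>.
\<close>

definition positive_semidefinite :: "real mat \<Rightarrow> bool" where
  "positive_semidefinite A \<longleftrightarrow>
     square_mat A \<and> transpose_mat A = A \<and>
     (\<forall>v \<in> carrier_vec (dim_row A). 0 \<le> scalar_prod v (A *\<^sub>v v))"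

definition positive_definite :: "real mat \<Rightarrow> bool" where
  "positive_definite A \<longleftrightarrow>
     square_mat A \<and> transpose_mat A = A \<and>
     (\<forall>v \<in> carrier_vec (dim_row A). v \<noteq> 0\<^sub>v (dim_row A) \<longrightarrow> 0 < scalar_prod v (A *\<^sub>v v))"

definition restrict_mat :: "real mat \<Rightarrow> nat set \<Rightarrow> real mat" where
  "restrict_mat A S =
     Matrix.mat (dim_row A) (dim_col A) (\<lambda>(i, j). if i \<in> S \<and> j \<in> S then A $$ (i, j) else 0)"

definition is_moore_penrose :: "real mat \<Rightarrow> real mat \<Rightarrow> bool" where
  "is_moore_penrose A X \<longleftrightarrow>
     X \<in> carrier_mat (dim_col A) (dim_row A) \<and>
     A * X * A = A \<and>
     X * A * X = X \<and>
     transpose_mat (A * X) = A * X \<and>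
     transpose_mat (X * A) = X * A"

definition pseudoinverse :: "real mat \<Rightarrow> real mat" where
  "pseudoinverse A = (THE X. is_moore_penrose A X)"

definition principal_minor :: "real mat \<Rightarrow> nat set \<Rightarrow> real" where
  "principal_minor A S = Determinant.det (submatrix A S S)"

lemma det_positive_semidefinite:
  assumes A: "positive_semidefinite A"
  shows "0 \<le> Determinant.det A"
proof -
  define n where "n = dim_row A"
  have Ac: "A \<in> carrier_mat n n"
    using A by (auto simp: positive_semidefinite_def n_def)
  have mA: "- A \<in> carrier_mat n n" using Ac by auto
  let ?p = "char_poly (- A)"
  have mon: "lead_coeff ?p = 1" using degree_monic_char_poly[OF mA] by auto
  have noroot: "poly ?p x \<noteq> 0" if x: "x > 0" for x
  proof
    assume "poly ?p x = 0"
    then have "eigenvalue (- A) x" using eigenvalue_root_char_poly[OF mA] by simp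
    then obtain v where v: "v \<in> carrier_vec n" "v \<noteq> 0\<^sub>v n" "(- A) *\<^sub>v v = x \<cdot>\<^sub>v v"
      using mA by (auto simp: eigenvalue_def eigenvector_def)
    have "scalar_prod v ((- A) *\<^sub>v v) = - scalar_prod v (A *\<^sub>v v)"
      using v(1) Ac by (simp add: uminus_mult_mat_vec)
    moreover have "scalar_prod v (A *\<^sub>v v) \<ge> 0"
      using A v(1) by (auto simp: positive_semidefinite_def n_def)
    moreover have "scalar_prod v ((- A) *\<^sub>v v) = x * scalar_prod v v"
      using v by simp
    moreover have "scalar_prod v v > 0"
    proof -
      obtain i where i: "i < n" "v $ i \<noteq> 0"
        using v(1,2) by (metis carrier_vecD eq_vecI index_zero_vec(1,2))
      have "0 < (\<Sum>j = 0..<n. v $ j * v $ j)"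
        by (rule sum_pos2[of _ i])
          (use i in \<open>auto simp: not_square_less_zero zero_less_mult_iff\<close>)
      then show ?thesis using v(1) by (simp add: scalar_prod_def)
    qed
    ultimately show False using x by (smt (verit) mult_pos_pos)
  qed
  have pos: "poly ?p x > 0" if x: "x > 0" for x
  proof (rule ccontr)
    assume "\<not> poly ?p x > 0"
    then have neg: "poly ?p x < 0" using noroot[OF x] by linarith
    from poly_pinfty_gt_lc[of ?p] mon obtain m where m: "\<And>y. y \<ge> m \<Longrightarrow> poly ?p y \<ge> 1"
      by auto
    define y where "y = max m (x + 1)"
    have "poly ?p y > 0" using m[of y] by (simp add: y_def)
    moreover have "x < y" by (simp add: y_def)
    ultimately obtain z where "z > x" "poly ?p z = 0"
      using poly_IVT_pos[of x y ?p] neg by blast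
    then show False using noroot[of z] x by simp
  qed
  have "(poly ?p \<longlongrightarrow> poly ?p 0) (at_right 0)"
    using isCont_def poly_isCont[of 0 ?p] filterlim_at_split by blast
  then have "0 \<le> poly ?p 0"
  proof (rule tendsto_lowerbound)
    show "\<forall>\<^sub>F x in at_right 0. 0 \<le> poly ?p x"
      using eventually_at_right_less[of 0] by (rule eventually_mono) (use pos in \<open>simp add: less_imp_le\<close>)
  qed simp
  moreover have "- char_matrix (- A) 0 = A"
    using Ac by (intro eq_matI) (auto simp: char_matrix_def)
  ultimately show ?thesis using char_poly_matrix[OF mA, of 0] by simp
qed

lemma principal_minor_nonneg:
  assumes A: "positive_semidefinite A" and S: "S \<subseteq> {..<dim_row A}"
  shows "0 \<le> principal_minor A S"
proof -
  define n k where "n = dim_row A" and "k = card S"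
  have Ac: "A \<in> carrier_mat n n" and At: "transpose_mat A = A"
    using A by (auto simp: positive_semidefinite_def n_def)
  have sub: "{i. i < n \<and> i \<in> S} = S" using S by (auto simp: n_def)
  have fin: "finite S" using S finite_subset by blast
  let ?B = "submatrix A S S"
  have Bc: "?B \<in> carrier_mat k k"
    using Ac by (intro carrier_matI) (auto simp: dim_submatrix sub k_def)
  have bij: "bij_betw (pick S) {0..<k} S"
  proof (rule bij_betwI[where g = "\<lambda>i. card {a \<in> S. a < i}"])
    show "pick S \<in> {0..<k} \<rightarrow> S" by (auto simp: k_def pick_in_set_le)
    show "(\<lambda>i. card {a \<in> S. a < i}) \<in> S \<rightarrow> {0..<k}"
      using fin by (auto simp: k_def intro!: psubset_card_mono)
    show "card {a \<in> S. a < pick S i} = i" if "i \<in> {0..<k}" for i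
      using that by (simp add: k_def card_pick_le)
    show "pick S (card {a \<in> S. a < i}) = i" if "i \<in> S" for i
      using that by (rule pick_card_in_set)
  qed
  have pickS: "pick S i \<in> S" if "i < k" for i using that by (simp add: k_def pick_in_set_le)
  have pickn: "pick S i < n" if "i < k" for i using pickS[OF that] S by (auto simp: n_def)
  have Bidx: "?B $$ (i, j) = A $$ (pick S i, pick S j)" if "i < k" "j < k" for i j
    using that Ac by (intro submatrix_index) (auto simp: sub k_def)
  have "positive_semidefinite ?B"
    unfolding positive_semidefinite_def
  proof (intro conjI ballI)
    show "square_mat ?B" using Bc by auto
    show "transpose_mat ?B = ?B"
    proof (rule eq_matI)
      fix i j assume "i < dim_row ?B" "j < dim_col ?B"
      then have ij: "i < k" "j < k" using Bc by auto
      have "A $$ (pick S j, pick S i) = transpose_mat A $$ (pick S i, pick S j)"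
        using Ac ij pickn by simp
      then show "transpose_mat ?B $$ (i, j) = ?B $$ (i, j)"
        using Bc ij by (simp add: Bidx At)
    qed (use Bc in auto)
    fix v :: "real vec" assume "v \<in> carrier_vec (dim_row ?B)"
    then have v: "v \<in> carrier_vec k" using Bc by auto
    define w where "w = Matrix.vec n (\<lambda>i. if i \<in> S then v $ card {a \<in> S. a < i} else 0)"
    have w: "w \<in> carrier_vec n" by (simp add: w_def)
    have wp: "w $ pick S i = v $ i" if "i < k" for i
      using that by (simp add: w_def pickS pickn) (simp add: k_def card_pick_le)
    have w0: "w $ i = 0" if "i < n" "i \<notin> S" for i using that by (simp add: w_def)
    have red: "(\<Sum>i = 0..<n. w $ i * f i) = (\<Sum>i = 0..<k. v $ i * f (pick S i))" for f
    proof -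
      have "(\<Sum>i = 0..<n. w $ i * f i) = (\<Sum>i\<in>S. w $ i * f i)"
        by (rule sum.mono_neutral_right) (use S w0 in \<open>auto simp: n_def\<close>)
      also have "\<dots> = (\<Sum>i = 0..<k. w $ pick S i * f (pick S i))"
        by (rule sum.reindex_bij_betw[OF bij, symmetric])
      finally show ?thesis by (simp add: wp)
    qed
    have "0 \<le> scalar_prod w (A *\<^sub>v w)"
      using A w by (auto simp: positive_semidefinite_def n_def)
    also have "scalar_prod w (A *\<^sub>v w) = (\<Sum>i = 0..<n. w $ i * (\<Sum>j = 0..<n. w $ j * A $$ (i, j)))"
      using Ac w by (auto simp: scalar_prod_def mult.commute intro!: sum.cong)
    also have "\<dots> = (\<Sum>i = 0..<k. v $ i * (\<Sum>j = 0..<k. v $ j * A $$ (pick S i, pick S j)))"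
      by (simp only: red)
    also have "\<dots> = scalar_prod v (?B *\<^sub>v v)"
      using Bc v by (auto simp: scalar_prod_def Bidx mult.commute intro!: sum.cong)
    finally show "0 \<le> scalar_prod v (?B *\<^sub>v v)" .
  qed
  then show ?thesis unfolding principal_minor_def by (rule det_positive_semidefinite)
qed

lemma principal_minor_empty [simp]: "principal_minor A {} = 1"
proof -
  have "submatrix A {} {} \<in> carrier_mat 0 0"
    by (rule carrier_matI) (simp_all add: dim_submatrix)
  then show ?thesis by (simp add: principal_minor_def)
qed

text \<open>
  For positive semidefinite \<open>A\<close> the weights below are a probability mass function;
  see \<open>pmf_dpp\<close>.
\<close>

definition dpp :: "real mat \<Rightarrow> nat set pmf" where
  "dpp A = embed_pmf (\<lambda>S.
     if S \<subseteq> {..<dim_row A}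
     then principal_minor A S / (\<Sum>T\<in>Pow {..<dim_row A}. principal_minor A T)
     else 0)"

definition mat_expectation :: "nat \<Rightarrow> nat \<Rightarrow> 'w measure \<Rightarrow> ('w \<Rightarrow> real mat) \<Rightarrow> real mat" where
  "mat_expectation m n P X = Matrix.mat m n (\<lambda>(i, j). \<integral>\<omega>. X \<omega> $$ (i, j) \<partial>P)"

lemma pmf_dpp:
  assumes A: "positive_semidefinite A"
  shows "pmf (dpp A) S =
    (if S \<subseteq> {..<dim_row A}
     then principal_minor A S / (\<Sum>T\<in>Pow {..<dim_row A}. principal_minor A T)
     else 0)"
proof -
  let ?D = "Pow {..<dim_row A}"
  let ?Z = "\<Sum>T\<in>?D. principal_minor A T"
  let ?f = "\<lambda>S. if S \<subseteq> {..<dim_row A} then principal_minor A S / ?Z else 0"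
  have Z: "?Z > 0"
    by (rule sum_pos2[of _ "{}"]) (auto simp: principal_minor_nonneg[OF A])
  have nn: "?f T \<ge> 0" for T
    using Z principal_minor_nonneg[OF A, of T] by simp
  have "(\<integral>\<^sup>+ T. ennreal (?f T) \<partial>count_space UNIV) = (\<Sum>T\<in>?D. ennreal (?f T))"
    by (rule nn_integral_count_space'[of ?D]) auto
  also have "\<dots> = ennreal (\<Sum>T\<in>?D. ?f T)"
    using nn by (intro sum_ennreal)
  also have "(\<Sum>T\<in>?D. ?f T) = (\<Sum>T\<in>?D. principal_minor A T / ?Z)"
    by (rule sum.cong) auto
  also have "\<dots> = 1" using Z by (subst sum_divide_distrib[symmetric]) simp
  finally have int1: "(\<integral>\<^sup>+ T. ennreal (?f T) \<partial>count_space UNIV) = 1" by simp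
  show ?thesis unfolding dpp_def by (rule pmf_embed_pmf) (fact nn, fact int1)
qed

end

theory Submission
  imports Defs
begin

text \<open>
  The theorem is Cramer's rule for \<open>\<alpha>I + M\<close>, with both determinants in the rule expanded as
  polynomials in the diagonal shift. Write \<open>N\<^sub>S\<close> for the matrix whose columns with index in \<open>S\<close> are
  those of \<open>M\<close> and whose other columns are unit vectors (\<open>cols_or_unit M S\<close>). Expanding the
  determinant multilinearly along the columns gives, for every diagonal shift \<open>c\<close>,
  \<open>det (diag c + M) = \<Sum>S. (\<Prod>k\<notin>S. c k) * det N\<^sub>S\<close> (\<open>det_add_mat_diag\<close>), and \<open>det N\<^sub>S\<close> is the
  principal minor of \<open>M\<close> at \<open>S\<close> (\<open>det_cols_or_unit\<close>). With \<open>c = \<alpha>\<close> this says that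
  \<open>det (\<alpha>I + M)\<close> is the normalizing constant of the determinantal point process, once its
  weights are multiplied by \<open>\<alpha>\<^sup>d\<close>.

  By Cramer's rule the entry \<open>(i, j)\<close> of the inverse is the quotient by \<open>det (\<alpha>I + M)\<close> of the
  determinant in which column \<open>i\<close> is replaced by the \<open>j\<close>-th unit vector. The same expansion, now
  with \<open>c i = 0\<close>, leaves only the sets \<open>S\<close> containing \<open>i\<close>, and the term of such an \<open>S\<close> is a
  power of \<open>\<alpha>\<close> times the determinant of \<open>N\<^sub>S\<close> with column \<open>i\<close> replaced by the unit vector
  (\<open>det_shifted_replace_col\<close>). Cramer's rule for \<open>N\<^sub>S\<close> reads that determinant as
  \<open>det N\<^sub>S\<close> times an entry of the inverse of \<open>N\<^sub>S\<close>. Finally, setting the rows with index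
  outside \<open>S\<close> to zero in the inverse of \<open>N\<^sub>S\<close> produces exactly the pseudoinverse of \<open>M\<close> restricted to \<open>S\<close> (\<open>pseudoinverse_restrict_mat\<close>).
  Hence the numerator in Cramer's rule is the sum over \<open>S\<close> of the unnormalized weight of \<open>S\<close> times
  the entry of the pseudoinverse, and the quotient is the expectation.

  Working with the \<open>d\<close>-by-\<open>d\<close> matrices \<open>N\<^sub>S\<close> in place of submatrices keeps all indices in one
  range; the order-preserving enumeration of \<open>S\<close> behind a submatrix matters only for identifying
  \<open>det N\<^sub>S\<close> with the principal minor and for scaling a principal minor.
\<close>

section \<open>Selecting columns and coordinates\<close>

definition cols_or_unit :: "'a :: {zero,one} mat \<Rightarrow> nat set \<Rightarrow> 'a mat" where
  "cols_or_unit A S =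
     Matrix.mat (dim_row A) (dim_col A) (\<lambda>(r, k). if k \<in> S then A $$ (r, k) else if r = k then 1 else 0)"

definition coord_proj :: "nat \<Rightarrow> nat set \<Rightarrow> real mat" where
  "coord_proj d S = mat_diag d (\<lambda>k. of_bool (k \<in> S))"

lemma cols_or_unit_carrier [simp]:
  "A \<in> carrier_mat n m \<Longrightarrow> cols_or_unit A S \<in> carrier_mat n m"
  by (auto simp: cols_or_unit_def)

lemma coord_proj_carrier [simp]: "coord_proj d S \<in> carrier_mat d d"
  by (simp add: coord_proj_def)

lemma restrict_mat_carrier [simp]:
  "A \<in> carrier_mat n m \<Longrightarrow> restrict_mat A S \<in> carrier_mat n m"
  by (auto simp: restrict_mat_def)

section \<open>Determinants of diagonal shifts\<close>

text \<open>
  Column \<open>k\<close> of \<open>mat_diag d c + A\<close> is the sum of column \<open>k\<close> of \<open>A\<close> and \<open>c k\<close> times a unit vector.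
  Inside each product of the Leibniz formula, choosing one summand per column is
  the distributive law; \<open>S\<close> collects the columns where the summand from \<open>A\<close> is chosen.
  Allowing an arbitrary diagonal \<open>c\<close>, also with zero entries, lets one identity serve both the
  denominator and the numerators of Cramer's rule.
\<close>

lemma det_add_mat_diag:
  fixes A :: "'a :: comm_ring_1 mat"
  assumes A: "A \<in> carrier_mat d d"
  shows "Determinant.det (mat_diag d c + A) =
    (\<Sum>S\<in>Pow {..<d}. (\<Prod>k\<in>{..<d} - S. c k) * Determinant.det (cols_or_unit A S))"
proof -
  let ?P = "{p. p permutes {0..<d}}"
  let ?e = "\<lambda>p k. of_bool (p k = k) :: 'a"
  have col: "(\<Prod>k<d. cols_or_unit A S $$ (p k, k)) = (\<Prod>k\<in>S. A $$ (p k, k)) * (\<Prod>k\<in>{..<d} - S. ?e p k)"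
    if p: "p permutes {0..<d}" and S: "S \<subseteq> {..<d}" for p S
  proof -
    have "(\<Prod>k<d. cols_or_unit A S $$ (p k, k))
        = (\<Prod>k\<in>{..<d} - S. cols_or_unit A S $$ (p k, k)) * (\<Prod>k\<in>S. cols_or_unit A S $$ (p k, k))"
      using S by (intro prod.subset_diff) auto
    also have "(\<Prod>k\<in>S. cols_or_unit A S $$ (p k, k)) = (\<Prod>k\<in>S. A $$ (p k, k))"
      using S A permutes_in_image[OF p] by (intro prod.cong) (auto simp: cols_or_unit_def)
    also have "(\<Prod>k\<in>{..<d} - S. cols_or_unit A S $$ (p k, k)) = (\<Prod>k\<in>{..<d} - S. ?e p k)"
      using S A permutes_in_image[OF p] by (intro prod.cong) (auto simp: cols_or_unit_def)
    finally show ?thesis by (simp add: mult.commute)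
  qed
  have expand: "(\<Prod>k<d. (mat_diag d c + A) $$ (p k, k)) =
      (\<Sum>S\<in>Pow {..<d}. (\<Prod>k\<in>{..<d} - S. c k) * (\<Prod>k<d. cols_or_unit A S $$ (p k, k)))"
    if p: "p permutes {0..<d}" for p
  proof -
    have "(\<Prod>k<d. (mat_diag d c + A) $$ (p k, k)) = (\<Prod>k<d. A $$ (p k, k) + c k * ?e p k)"
      using A permutes_in_image[OF p] by (intro prod.cong) (auto simp: mat_diag_def)
    also have "\<dots> = (\<Sum>S\<in>Pow {..<d}. (\<Prod>k\<in>S. A $$ (p k, k)) * (\<Prod>k\<in>{..<d} - S. c k * ?e p k))"
      by (rule prod_add) simp
    also have "\<dots> = (\<Sum>S\<in>Pow {..<d}. (\<Prod>k\<in>{..<d} - S. c k) * (\<Prod>k<d. cols_or_unit A S $$ (p k, k)))"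
      by (intro sum.cong refl) (auto simp: col[OF p] prod.distrib mult_ac)
    finally show ?thesis .
  qed
  have "Determinant.det (mat_diag d c + A) =
      (\<Sum>p\<in>?P. signof p * (\<Prod>k<d. (mat_diag d c + A) $$ (p k, k)))"
    using A by (intro det_col) auto
  also have "\<dots> = (\<Sum>p\<in>?P. \<Sum>S\<in>Pow {..<d}.
      (\<Prod>k\<in>{..<d} - S. c k) * (signof p * (\<Prod>k<d. cols_or_unit A S $$ (p k, k))))"
    by (intro sum.cong refl) (simp add: expand sum_distrib_left mult_ac)
  also have "\<dots> = (\<Sum>S\<in>Pow {..<d}. (\<Prod>k\<in>{..<d} - S. c k) *
      (\<Sum>p\<in>?P. signof p * (\<Prod>k<d. cols_or_unit A S $$ (p k, k))))"
    by (subst sum.swap) (simp add: sum_distrib_left)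
  also have "\<dots> = (\<Sum>S\<in>Pow {..<d}. (\<Prod>k\<in>{..<d} - S. c k) * Determinant.det (cols_or_unit A S))"
    using A by (simp add: det_col[of _ d])
  finally show ?thesis .
qed

text \<open>
  The sign of the permutation enters once for the rows and once for the columns.
\<close>

lemma det_permute_rows_cols:
  fixes A :: "'a :: comm_ring_1 mat"
  assumes A: "A \<in> carrier_mat n n" and p: "p permutes {0..<n}"
  shows "Determinant.det (Matrix.mat n n (\<lambda>(i, j). A $$ (p i, p j))) = Determinant.det A"
proof -
  define B where "B = Matrix.mat n n (\<lambda>(i, j). A $$ (p i, j))"
  have B: "B \<in> carrier_mat n n" by (simp add: B_def)
  have pn: "p i < n" if "i < n" for i using permutes_in_image[OF p, of i] that by simp
  have "Matrix.mat n n (\<lambda>(i, j). A $$ (p i, p j))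
      = transpose_mat (Matrix.mat n n (\<lambda>(i, j). transpose_mat B $$ (p i, j)))"
    using pn by (intro eq_matI) (auto simp: B_def)
  then have "Determinant.det (Matrix.mat n n (\<lambda>(i, j). A $$ (p i, p j)))
      = Determinant.det (Matrix.mat n n (\<lambda>(i, j). transpose_mat B $$ (p i, j)))"
    by (simp add: det_transpose[of _ n])
  also have "\<dots> = signof p * Determinant.det B"
    using B p by (subst det_permute_rows) (auto simp: det_transpose)
  also have "\<dots> = signof p * (signof p * Determinant.det A)"
    unfolding B_def using A p by (subst det_permute_rows) auto
  also have "\<dots> = Determinant.det A" by (simp add: sign_def)
  finally show ?thesis .
qed

lemma bij_betw_pick:
  assumes "finite T"
  shows "bij_betw (pick T) {0..<card T} T"
proof (rule bij_betwI[where g = "\<lambda>i. card {a \<in> T. a < i}"])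
  show "pick T \<in> {0..<card T} \<rightarrow> T" by (auto simp: pick_in_set_le)
  show "(\<lambda>i. card {a \<in> T. a < i}) \<in> T \<rightarrow> {0..<card T}"
    using assms by (auto intro!: psubset_card_mono)
  show "card {a \<in> T. a < pick T i} = i" if "i \<in> {0..<card T}" for i
    using that by (simp add: card_pick_le)
  show "pick T (card {a \<in> T. a < i}) = i" if "i \<in> T" for i
    using that by (rule pick_card_in_set)
qed

text \<open>
  Listing the indices in \<open>S\<close> before the others turns \<open>cols_or_unit A S\<close> into a block lower
  triangular matrix with diagonal blocks the principal submatrix and an identity.
\<close>

lemma det_cols_or_unit:
  assumes A: "A \<in> carrier_mat d d" and S: "S \<subseteq> {..<d}"
  shows "Determinant.det (cols_or_unit A S) = principal_minor A S"
proof -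
  \<comment> \<open>The permutation \<open>p\<close> enumerates \<open>S\<close> increasingly, as a submatrix does, and then the rest.\<close>
  define k T where "k = card S" and "T = {0..<d} - S"
  define p where "p i = (if i < k then pick S i else if i < d then pick T (i - k) else i)" for i
  have fin: "finite S" "finite T" using S finite_subset by (auto simp: T_def)
  have ST: "S \<union> T = {0..<d}" "S \<inter> T = {}" using S by (auto simp: T_def)
  have kd: "k \<le> d" unfolding k_def using S card_mono[of "{..<d}" S] by simp
  have cT: "card T = d - k"
    unfolding T_def k_def using S fin by (subst card_Diff_subset) (auto simp: lessThan_atLeast0)
  have "bij_betw (\<lambda>i. i - k) {k..<d} {0..<card T}"
    unfolding cT by (rule bij_betwI[where g = "\<lambda>i. i + k"]) auto
  from bij_betw_trans[OF this bij_betw_pick[OF fin(2)]]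
  have "bij_betw p {k..<d} T"
    by (rule bij_betw_cong[THEN iffD1, rotated]) (auto simp: p_def)
  moreover have "bij_betw p {0..<k} S"
    by (rule bij_betw_cong[THEN iffD1, rotated, OF bij_betw_pick[OF fin(1), folded k_def]])
      (auto simp: p_def)
  ultimately have bij: "bij_betw p ({0..<k} \<union> {k..<d}) (S \<union> T)"
    using ST(2) by (intro bij_betw_combine)
  moreover have "{0..<k} \<union> {k..<d} = {0..<d}" using kd by auto
  ultimately have p: "p permutes {0..<d}"
    unfolding ST(1) by (intro bij_imp_permutes) (use kd in \<open>auto simp: p_def\<close>)
  have pd: "p i < d" if "i < d" for i using permutes_in_image[OF p, of i] that by simp
  have pS: "p i \<in> S \<longleftrightarrow> i < k" if "i < d" for i
  proof (cases "i < k")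
    case False
    then have "p i \<in> T" using that cT by (auto simp: p_def intro!: pick_in_set_le)
    then show ?thesis using False ST(2) by auto
  qed (auto simp: p_def k_def pick_in_set_le)
  have pinj: "p i = p j \<longleftrightarrow> i = j" for i j using permutes_inj[OF p] by (auto simp: inj_def)
  define N where "N = Matrix.mat d d (\<lambda>(i, j). cols_or_unit A S $$ (p i, p j))"
  define C where "C = Matrix.mat (d - k) k (\<lambda>(i, j). A $$ (p (i + k), p j))"
  have sub: "{i. i < d \<and> i \<in> S} = S" using S by auto
  have B: "submatrix A S S \<in> carrier_mat k k"
    using A by (intro carrier_matI) (auto simp: dim_submatrix sub k_def)
  have Bidx: "submatrix A S S $$ (i, j) = A $$ (pick S i, pick S j)" if "i < k" "j < k" for i j
    using that A by (intro submatrix_index) (auto simp: sub k_def)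
  have "N = four_block_mat (submatrix A S S) (0\<^sub>m k (d - k)) C (1\<^sub>m (d - k))"
  proof (rule eq_matI)
    fix i j
    assume "i < dim_row (four_block_mat (submatrix A S S) (0\<^sub>m k (d - k)) C (1\<^sub>m (d - k)))"
      and "j < dim_col (four_block_mat (submatrix A S S) (0\<^sub>m k (d - k)) C (1\<^sub>m (d - k)))"
    then have ij: "i < d" "j < d" using B kd by auto
    then have "N $$ (i, j) = (if j < k then A $$ (p i, p j) else if i = j then 1 else 0)"
      using A by (simp add: N_def cols_or_unit_def pd pS pinj)
    then show "N $$ (i, j) = four_block_mat (submatrix A S S) (0\<^sub>m k (d - k)) C (1\<^sub>m (d - k)) $$ (i, j)"
      using ij B kd by (auto simp: C_def Bidx p_def)
  qed (use B kd in \<open>auto simp: N_def\<close>)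
  then have "Determinant.det N = Determinant.det (submatrix A S S)"
    using det_four_block_mat_upper_right_zero[OF B refl, of C "d - k" "1\<^sub>m (d - k)"] by (simp add: C_def)
  then show ?thesis
    using det_permute_rows_cols[OF _ p, of "cols_or_unit A S"] A by (simp add: N_def principal_minor_def)
qed

lemma principal_minor_smult:
  assumes "A \<in> carrier_mat d d" and "S \<subseteq> {..<d}"
  shows "principal_minor (c \<cdot>\<^sub>m A) S = c ^ card S * principal_minor A S"
proof -
  have sub: "{i. i < d \<and> i \<in> S} = S" using assms(2) by auto
  have "pick S i < d" if "i < card S" for i using pick_in_set_le[OF that] assms(2) by auto
  then have "submatrix (c \<cdot>\<^sub>m A) S S = c \<cdot>\<^sub>m submatrix A S S"
    using assms by (intro eq_matI) (auto simp: dim_submatrix submatrix_index sub)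
  then show ?thesis using assms(1) by (simp add: principal_minor_def dim_submatrix sub)
qed

section \<open>Coordinate projections\<close>

lemma cols_or_unit_eq:
  assumes A: "A \<in> carrier_mat d d"
  shows "cols_or_unit A S = A * coord_proj d S + coord_proj d (- S)"
  unfolding coord_proj_def mat_diag_mult_right[OF A]
  using A by (intro eq_matI) (auto simp: cols_or_unit_def mat_diag_def)

lemma coord_proj_mult_cols_or_unit:
  assumes A: "A \<in> carrier_mat d d"
  shows "coord_proj d S * cols_or_unit A S = restrict_mat A S"
  unfolding coord_proj_def mat_diag_mult_left[OF cols_or_unit_carrier[OF A]]
  using A by (intro eq_matI) (auto simp: cols_or_unit_def restrict_mat_def)

lemma cols_or_unit_mult_coord_proj:
  assumes A: "A \<in> carrier_mat d d"
  shows "cols_or_unit A S * coord_proj d (- S) = coord_proj d (- S)"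
  unfolding coord_proj_def mat_diag_mult_right[OF cols_or_unit_carrier[OF A]]
  using A by (intro eq_matI) (auto simp: cols_or_unit_def mat_diag_def)

lemma restrict_mat_mult_coord_proj:
  assumes A: "A \<in> carrier_mat d d"
  shows "restrict_mat A S * coord_proj d S = restrict_mat A S"
  unfolding coord_proj_def mat_diag_mult_right[OF restrict_mat_carrier[OF A]]
  using A by (intro eq_matI) (auto simp: restrict_mat_def)

lemma coord_proj_mult_restrict_mat:
  assumes A: "A \<in> carrier_mat d d"
  shows "coord_proj d S * restrict_mat A S = restrict_mat A S"
  unfolding coord_proj_def mat_diag_mult_left[OF restrict_mat_carrier[OF A]]
  using A by (intro eq_matI) (auto simp: restrict_mat_def)

lemma coord_proj_idem: "coord_proj d S * coord_proj d S = coord_proj d S"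
  unfolding coord_proj_def mat_diag_diag by (intro eq_matI) (auto simp: mat_diag_def)

lemma coord_proj_compl_mult: "coord_proj d S * coord_proj d (- S) = 0\<^sub>m d d"
  unfolding coord_proj_def mat_diag_diag by (intro eq_matI) (auto simp: mat_diag_def)

lemma coord_proj_add_compl: "coord_proj d S + coord_proj d (- S) = 1\<^sub>m d"
  by (auto simp: coord_proj_def mat_diag_def intro!: eq_matI)

lemma transpose_coord_proj: "transpose_mat (coord_proj d S) = coord_proj d S"
  by (auto simp: coord_proj_def mat_diag_def intro!: eq_matI)

lemma index_coord_proj_mult_vec:
  assumes v: "v \<in> carrier_vec d" and i: "i < d"
  shows "(coord_proj d S *\<^sub>v v) $ i = (if i \<in> S then v $ i else 0)"
proof -
  have "(coord_proj d S *\<^sub>v v) $ i = (\<Sum>k = 0..<d. (if i = k then of_bool (k \<in> S) else 0) * v $ k)"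
    using v i by (simp add: coord_proj_def mat_diag_def scalar_prod_def)
  also have "\<dots> = (\<Sum>k = 0..<d. if k = i then of_bool (i \<in> S) * v $ i else 0)"
    by (intro sum.cong) auto
  finally show ?thesis using i by simp
qed

text \<open>
  If \<open>cols_or_unit M S\<close> annihilates \<open>v\<close>, split \<open>v = w + u\<close> into its parts on and off \<open>S\<close>; then
  \<open>M w = - u\<close>. Since \<open>w\<close> and \<open>u\<close> have disjoint supports, the quadratic form of \<open>M\<close> vanishes at
  \<open>w\<close>, so \<open>w = 0\<close> by definiteness and therefore \<open>u = 0\<close>.
\<close>

lemma det_cols_or_unit_nonzero:
  assumes M: "M \<in> carrier_mat d d" and pd: "positive_definite M"
  shows "Determinant.det (cols_or_unit M S) \<noteq> 0"
proof
  assume "Determinant.det (cols_or_unit M S) = 0"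
  then obtain v where v: "v \<in> carrier_vec d" "v \<noteq> 0\<^sub>v d" "cols_or_unit M S *\<^sub>v v = 0\<^sub>v d"
    using M det_0_iff_vec_prod_zero[of "cols_or_unit M S" d] by auto
  define w u where "w = coord_proj d S *\<^sub>v v" and "u = coord_proj d (- S) *\<^sub>v v"
  have w: "w \<in> carrier_vec d" and u: "u \<in> carrier_vec d"
    by (simp_all add: w_def u_def mult_mat_vec_carrier[of _ d d] v)
  have wi: "w $ i = (if i \<in> S then v $ i else 0)" and ui: "u $ i = (if i \<in> S then 0 else v $ i)"
    if "i < d" for i
    using index_coord_proj_mult_vec[OF v(1) that] by (simp_all add: w_def u_def)
  have split: "M *\<^sub>v w + u = 0\<^sub>v d"
    unfolding v(3)[symmetric] cols_or_unit_eq[OF M] w_def u_def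
    using M v(1) by (simp add: add_mult_distrib_mat_vec[of _ d d] assoc_mult_mat_vec[of M d d _ d])
  have Mw: "(M *\<^sub>v w) $ i = - u $ i" if "i < d" for i
  proof -
    have "(M *\<^sub>v w + u) $ i = 0" using split that by simp
    then show ?thesis using that M u by simp
  qed
  have "scalar_prod w (M *\<^sub>v w) = 0"
    using M w by (auto simp: scalar_prod_def[of w "M *\<^sub>v w"] Mw wi ui simp del: index_mult_mat_vec
        intro!: sum.neutral)
  then have w0: "w = 0\<^sub>v d" using pd M w unfolding positive_definite_def by force
  have "M *\<^sub>v 0\<^sub>v d = 0\<^sub>v d" using M by (intro eq_vecI) auto
  then have u0: "u = 0\<^sub>v d" using split w0 u by simp
  have "v = 0\<^sub>v d"
  proof (rule eq_vecI)
    fix i assume i: "i < dim_vec (0\<^sub>v d :: real vec)"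
    then have "w $ i = 0" "u $ i = 0" using w0 u0 by simp_all
    then show "v $ i = 0\<^sub>v d $ i" using i wi[of i] ui[of i] by (simp split: if_splits)
  qed (use v in simp)
  with v(2) show False ..
qed

section \<open>The pseudoinverse of a restricted matrix\<close>

text \<open>
  Symmetry allows the factors of a product of the projections \<open>A * X\<close> and \<open>A * Y\<close> onto the column
  space of \<open>A\<close> to be interchanged, whence \<open>A * X = A * Y\<close>; likewise \<open>X * A = Y * A\<close>. Then
  \<open>X = X * A * X = X * A * Y = Y * A * Y = Y\<close>.
\<close>

lemma moore_penrose_unique:
  assumes X: "is_moore_penrose A X" and Y: "is_moore_penrose A Y"
  shows "X = Y"
proof -
  define m n where "m = dim_row A" and "n = dim_col A"
  have c [simp]: "A \<in> carrier_mat m n" "X \<in> carrier_mat n m" "Y \<in> carrier_mat n m"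
    using X Y by (auto simp: is_moore_penrose_def m_def n_def)
  have c2 [simp]: "A * X \<in> carrier_mat m m" "A * Y \<in> carrier_mat m m"
    "X * A \<in> carrier_mat n n" "Y * A \<in> carrier_mat n n"
    by (auto intro!: mult_carrier_mat[OF c(1)] mult_carrier_mat[OF _ c(1)])
  note x = X[unfolded is_moore_penrose_def] and y = Y[unfolded is_moore_penrose_def]
  have "A * X = A * Y * A * X" using y by simp
  also have "\<dots> = (A * Y) * (A * X)" by (rule assoc_mult_mat[of _ m m _ n _ m]) auto
  also have "\<dots> = transpose_mat (A * Y) * transpose_mat (A * X)" using x y by simp
  also have "\<dots> = transpose_mat ((A * X) * (A * Y))" by (rule transpose_mult[of _ m m _ m, symmetric]) auto
  also have "(A * X) * (A * Y) = A * X * A * Y" by (rule assoc_mult_mat[of _ m m _ n _ m, symmetric]) auto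
  also have "\<dots> = A * Y" using x by simp
  also have "transpose_mat (A * Y) = A * Y" using y by simp
  finally have AXY: "A * X = A * Y" .
  have "Y * A = Y * (A * X * A)" using x by simp
  also have "\<dots> = Y * (A * (X * A))" by (simp add: assoc_mult_mat[of _ m n _ m _ n])
  also have "\<dots> = (Y * A) * (X * A)" by (rule assoc_mult_mat[of _ n m _ n _ n, symmetric]) auto
  also have "\<dots> = transpose_mat (Y * A) * transpose_mat (X * A)" using x y by simp
  also have "\<dots> = transpose_mat ((X * A) * (Y * A))" by (rule transpose_mult[of _ n n _ n, symmetric]) auto
  also have "(X * A) * (Y * A) = X * (A * (Y * A))" by (rule assoc_mult_mat[of _ n m _ n _ n]) auto
  also have "A * (Y * A) = A * Y * A" by (rule assoc_mult_mat[of _ m n _ m _ n, symmetric]) auto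
  also have "\<dots> = A" using y by simp
  also have "transpose_mat (X * A) = X * A" using x by simp
  finally have YXA: "Y * A = X * A" .
  have "X = X * A * X" using x by simp
  also have "\<dots> = X * (A * X)" by (rule assoc_mult_mat[of _ n m _ n _ m]) auto
  also have "\<dots> = X * (A * Y)" by (simp only: AXY)
  also have "\<dots> = X * A * Y" by (rule assoc_mult_mat[of _ n m _ n _ m, symmetric]) auto
  also have "\<dots> = Y * A * Y" by (simp only: YXA)
  also have "\<dots> = Y" using y by simp
  finally show ?thesis .
qed

lemma pseudoinverse_eqI: "is_moore_penrose A X \<Longrightarrow> pseudoinverse A = X"
  unfolding pseudoinverse_def by (rule the_equality) (auto intro: moore_penrose_unique)

section \<open>Inverse matrices and Cramer's rule\<close>

lemma obtain_mat_inverse: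
  fixes A :: "'a :: field mat"
  assumes A: "A \<in> carrier_mat n n" and "Determinant.det A \<noteq> 0"
  obtains B where "B \<in> carrier_mat n n" "A * B = 1\<^sub>m n" "B * A = 1\<^sub>m n" "mat_inverse A = Some B"
proof (cases "mat_inverse A")
  case None
  then show ?thesis
    using mat_inverse(1)[OF A None, of "()"] det_non_zero_imp_unit[OF assms, of "()"] by simp
next
  case (Some B)
  then show ?thesis using mat_inverse(2)[OF A Some] that by blast
qed

text \<open>
  Column \<open>j\<close> of the inverse solves the linear system whose right-hand side is the \<open>j\<close>-th unit vector.
\<close>

lemma inverse_entry_cramer:
  fixes A :: "'a :: comm_ring_1 mat"
  assumes A: "A \<in> carrier_mat n n" and B: "B \<in> carrier_mat n n" and AB: "A * B = 1\<^sub>m n"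
    and ij: "i < n" "j < n"
  shows "Determinant.det A * B $$ (i, j) = Determinant.det (replace_col A (unit_vec n j) i)"
proof -
  have "A *\<^sub>v col B j = unit_vec n j"
    using col_mult2[OF A B ij(2)] AB ij(2) by simp
  then show ?thesis
    using cramer_lemma_mat[OF A, of "col B j" i] B ij by (simp add: mult.commute)
qed

text \<open>
  Let \<open>E\<close> and \<open>F\<close> be the coordinate projections on and off \<open>S\<close>, \<open>N = cols_or_unit A S\<close> with
  inverse \<open>V\<close>, and \<open>R = E * N\<close> the restricted matrix. Since \<open>N\<close> fixes the unit vectors off \<open>S\<close>, so
  does \<open>V\<close>, and \<open>E * V\<close> has no columns off \<open>S\<close>: \<open>E * V * E = E * V\<close>. Consequently \<open>E * V\<close>
  multiplied by \<open>R\<close> on either side gives \<open>E\<close>. As \<open>E\<close> is symmetric and acts as an identity on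
  both \<open>R\<close> and \<open>E * V\<close>, all four Moore-Penrose equations follow.
\<close>

lemma pseudoinverse_restrict_mat:
  assumes A: "A \<in> carrier_mat d d" and V: "V \<in> carrier_mat d d"
    and NV: "cols_or_unit A S * V = 1\<^sub>m d"
  shows "pseudoinverse (restrict_mat A S) = coord_proj d S * V"
proof (rule pseudoinverse_eqI)
  define N R E F where "N = cols_or_unit A S" and "R = restrict_mat A S"
    and "E = coord_proj d S" and "F = coord_proj d (- S)"
  have c [simp]: "N \<in> carrier_mat d d" "R \<in> carrier_mat d d" "E \<in> carrier_mat d d"
      "F \<in> carrier_mat d d" "V \<in> carrier_mat d d"
    using A V by (auto simp: N_def R_def E_def F_def)
  have m [simp]: "X * Y \<in> carrier_mat d d"
    if "X \<in> carrier_mat d d" "Y \<in> carrier_mat d d" for X Y :: "real mat"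
    using that by (rule mult_carrier_mat)
  note assoc = assoc_mult_mat[of _ d d _ d _ d]
  have VN: "V * N = 1\<^sub>m d" using NV mat_mult_left_right_inverse[OF c(1) c(5)] by (simp add: N_def)
  have EN: "E * N = R" using coord_proj_mult_cols_or_unit[OF A] by (simp add: E_def N_def R_def)
  have RE: "R * E = R" using restrict_mat_mult_coord_proj[OF A] by (simp add: E_def R_def)
  have ER: "E * R = R" using coord_proj_mult_restrict_mat[OF A] by (simp add: E_def R_def)
  have EE: "E * E = E" by (simp add: E_def coord_proj_idem)
  have RV: "R * V = E"
    unfolding EN[symmetric] using NV by (simp add: assoc N_def[symmetric] right_mult_one_mat[of _ d d])
  have "V * F = V * (N * F)" using cols_or_unit_mult_coord_proj[OF A] by (simp add: N_def F_def)
  also have "\<dots> = F" by (simp add: assoc[symmetric] VN left_mult_one_mat[of _ d d])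
  finally have VF: "V * F = F" .
  have "E * V = E * V * (E + F)" by (simp add: E_def F_def coord_proj_add_compl) (simp add: E_def[symmetric] right_mult_one_mat[of _ d d])
  also have "\<dots> = E * V * E + E * V * F" by (rule mult_add_distrib_mat[of _ d d _ d]) auto
  also have "E * V * F = E * F" by (simp add: assoc VF)
  also have "\<dots> = 0\<^sub>m d d" by (simp add: E_def F_def coord_proj_compl_mult)
  finally have EVE: "E * V * E = E * V" by (simp add: right_add_zero_mat[of _ d d])
  have RX: "R * (E * V) = E" by (simp add: assoc[symmetric] RE RV)
  have XR: "E * V * R = E"
  proof -
    have "E * V * R = E * V * E * N" by (simp add: EN[symmetric] assoc)
    also have "\<dots> = E" unfolding EVE by (simp add: assoc VN right_mult_one_mat[of _ d d])
    finally show ?thesis .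
  qed
  have "E * (E * V) = E * V" by (simp add: assoc[symmetric] EE)
  moreover have "transpose_mat E = E" by (simp add: E_def transpose_coord_proj)
  moreover have "dim_row R = d" "dim_col R = d" using carrier_matD[OF c(2)] by auto
  ultimately have "is_moore_penrose R (E * V)"
    unfolding is_moore_penrose_def RX XR ER by simp
  then show "is_moore_penrose (restrict_mat A S) (coord_proj d S * V)"
    by (simp add: R_def E_def)
qed

text \<open>
  Multiplying by the principal minor clears the denominator of Cramer's rule: each entry becomes a
  determinant of the kind that \<open>det_add_mat_diag\<close> produces.
\<close>

lemma principal_minor_times_pseudoinverse:
  assumes A: "A \<in> carrier_mat d d" and S: "S \<subseteq> {..<d}"
    and nz: "Determinant.det (cols_or_unit A S) \<noteq> 0" and ij: "i < d" "j < d"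
  shows "principal_minor A S * pseudoinverse (restrict_mat A S) $$ (i, j) =
    (if i \<in> S then Determinant.det (replace_col (cols_or_unit A S) (unit_vec d j) i) else 0)"
proof -
  have N: "cols_or_unit A S \<in> carrier_mat d d" using A by simp
  obtain V where V: "V \<in> carrier_mat d d" "cols_or_unit A S * V = 1\<^sub>m d"
    using obtain_mat_inverse[OF N nz] by metis
  have "pseudoinverse (restrict_mat A S) $$ (i, j) = (if i \<in> S then V $$ (i, j) else 0)"
    unfolding pseudoinverse_restrict_mat[OF A V] coord_proj_def mat_diag_mult_left[OF V(1)]
    using ij by simp
  then show ?thesis
    using inverse_entry_cramer[OF N V ij] by (simp add: det_cols_or_unit[OF A S])
qed

section \<open>Expansion of the shifted matrix\<close>

lemma det_shifted:
  assumes A: "A \<in> carrier_mat d d"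
  shows "Determinant.det ((\<alpha> \<cdot>\<^sub>m 1\<^sub>m d) + A) =
    (\<Sum>S\<in>Pow {..<d}. \<alpha> ^ (d - card S) * principal_minor A S)"
proof -
  have "(\<alpha> \<cdot>\<^sub>m 1\<^sub>m d) + A = mat_diag d (\<lambda>_. \<alpha>) + A"
    using A by (intro eq_matI) (auto simp: mat_diag_def)
  moreover have "(\<Prod>k\<in>{..<d} - S. \<alpha>) = \<alpha> ^ (d - card S)" if "S \<subseteq> {..<d}" for S
    using that finite_subset[OF that] by (simp add: card_Diff_subset)
  ultimately show ?thesis
    using A by (auto simp: det_add_mat_diag det_cols_or_unit intro!: sum.cong)
qed

text \<open>
  After the replacement, column \<open>i\<close> contains no multiple of \<open>\<alpha>\<close>, so the matrix is a
  diagonal shift of \<open>replace_col A (unit_vec d j) i\<close> by the diagonal that is \<open>0\<close> at \<open>i\<close> and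
  \<open>\<alpha>\<close> elsewhere. The zero removes every set that omits \<open>i\<close>.
\<close>

lemma det_shifted_replace_col:
  fixes A :: "real mat"
  assumes A: "A \<in> carrier_mat d d" and ij: "i < d" "j < d"
  shows "Determinant.det (replace_col ((\<alpha> \<cdot>\<^sub>m 1\<^sub>m d) + A) (unit_vec d j) i) =
    (\<Sum>S\<in>Pow {..<d}. \<alpha> ^ (d - card S) *
       (if i \<in> S then Determinant.det (replace_col (cols_or_unit A S) (unit_vec d j) i) else 0))"
proof -
  let ?c = "\<lambda>k. if k = i then 0 else \<alpha>"
  let ?A = "replace_col A (unit_vec d j) i"
  have A': "?A \<in> carrier_mat d d" using A by (auto simp: replace_col_def)
  have "replace_col ((\<alpha> \<cdot>\<^sub>m 1\<^sub>m d) + A) (unit_vec d j) i = mat_diag d ?c + ?A"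
    using A by (intro eq_matI) (auto simp: mat_diag_def replace_col_def)
  moreover have "(\<Prod>k\<in>{..<d} - S. ?c k) * Determinant.det (cols_or_unit ?A S) =
      \<alpha> ^ (d - card S) *
       (if i \<in> S then Determinant.det (replace_col (cols_or_unit A S) (unit_vec d j) i) else 0)"
    if S: "S \<subseteq> {..<d}" for S
  proof (cases "i \<in> S")
    case True
    have "(\<Prod>k\<in>{..<d} - S. ?c k) = (\<Prod>k\<in>{..<d} - S. \<alpha>)"
      using True by (intro prod.cong) auto
    also have "\<dots> = \<alpha> ^ (d - card S)"
      using S finite_subset[OF S] by (simp add: card_Diff_subset)
    finally have "(\<Prod>k\<in>{..<d} - S. ?c k) = \<alpha> ^ (d - card S)" .
    moreover have "cols_or_unit ?A S = replace_col (cols_or_unit A S) (unit_vec d j) i"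
      using A True by (intro eq_matI) (auto simp: cols_or_unit_def replace_col_def)
    ultimately show ?thesis using True by simp
  next
    case False
    then have "(\<Prod>k\<in>{..<d} - S. ?c k) = 0"
      using ij by (intro prod_zero) auto
    then show ?thesis using False by simp
  qed
  ultimately show ?thesis by (simp add: det_add_mat_diag[OF A'])
qed

section \<open>The determinantal point process and its expectations\<close>

lemma positive_definite_imp_semidefinite_smult:
  assumes "positive_definite M" and "c \<ge> 0"
  shows "positive_semidefinite (c \<cdot>\<^sub>m M)"
proof -
  define n where "n = dim_row M"
  have M: "M \<in> carrier_mat n n" "transpose_mat M = M"
    using assms by (auto simp: positive_definite_def n_def)
  have "transpose_mat (c \<cdot>\<^sub>m M) = c \<cdot>\<^sub>m transpose_mat M" by (intro eq_matI) auto
  then have sym: "transpose_mat (c \<cdot>\<^sub>m M) = c \<cdot>\<^sub>m M" using M(2) by simp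
  have "0 \<le> scalar_prod v ((c \<cdot>\<^sub>m M) *\<^sub>v v)" if v: "v \<in> carrier_vec n" for v
  proof -
    have "0 \<le> scalar_prod v (M *\<^sub>v v)"
    proof (cases "v = 0\<^sub>v n")
      case False
      then show ?thesis using assms(1) v by (auto simp: positive_definite_def n_def less_imp_le)
    qed (use M in auto)
    moreover have "scalar_prod v ((c \<cdot>\<^sub>m M) *\<^sub>v v) = c * scalar_prod v (M *\<^sub>v v)"
    proof -
      have "(c \<cdot>\<^sub>m M) *\<^sub>v v = c \<cdot>\<^sub>v (M *\<^sub>v v)"
        using M v by (intro eq_vecI) (auto simp: scalar_prod_def sum_distrib_left mult.assoc)
      then show ?thesis using M v by simp
    qed
    ultimately show ?thesis using assms(2) by simp
  qed
  then show ?thesis using M sym unfolding positive_semidefinite_def by auto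
qed

text \<open>
  The factor \<open>(1 / \<alpha>) ^ card S\<close> from the scaled minors becomes \<open>\<alpha>\<close> to the power \<open>d - card S\<close> after
  multiplication of numerator and denominator by \<open>\<alpha>\<^sup>d\<close>.
\<close>

lemma pmf_dpp_scaled:
  assumes M: "M \<in> carrier_mat d d" and pd: "positive_definite M" and \<alpha>: "\<alpha> > 0"
    and S: "S \<subseteq> {..<d}"
  shows "pmf (dpp ((1 / \<alpha>) \<cdot>\<^sub>m M)) S =
    \<alpha> ^ (d - card S) * principal_minor M S / Determinant.det ((\<alpha> \<cdot>\<^sub>m 1\<^sub>m d) + M)"
proof -
  have w: "principal_minor ((1 / \<alpha>) \<cdot>\<^sub>m M) T = \<alpha> ^ (d - card T) * principal_minor M T / \<alpha> ^ d"
    if T: "T \<subseteq> {..<d}" for T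
  proof -
    have "card T \<le> d" using card_mono[OF _ T] by simp
    then show ?thesis
      using \<alpha> by (simp add: principal_minor_smult[OF M T] power_diff power_one_over field_simps)
  qed
  have "(\<Sum>T\<in>Pow {..<d}. principal_minor ((1 / \<alpha>) \<cdot>\<^sub>m M) T)
      = Determinant.det ((\<alpha> \<cdot>\<^sub>m 1\<^sub>m d) + M) / \<alpha> ^ d"
    unfolding det_shifted[OF M] sum_divide_distrib by (intro sum.cong refl w) auto
  then show ?thesis
    using pmf_dpp[OF positive_definite_imp_semidefinite_smult[OF pd, of "1 / \<alpha>"], of S] \<alpha> M S
    by (simp add: w[OF S])
qed

lemma det_shifted_pos:
  assumes M: "M \<in> carrier_mat d d" and pd: "positive_definite M" and \<alpha>: "\<alpha> > 0"
  shows "Determinant.det ((\<alpha> \<cdot>\<^sub>m 1\<^sub>m d) + M) > 0"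
proof -
  have "1 \<cdot>\<^sub>m M = M" by (intro eq_matI) auto
  then have "positive_semidefinite M" using positive_definite_imp_semidefinite_smult[OF pd, of 1] by simp
  then have "0 \<le> principal_minor M T" if "T \<subseteq> {..<d}" for T
    using principal_minor_nonneg[of M T] that M by auto
  then show ?thesis
    unfolding det_shifted[OF M] using \<alpha> by (intro sum_pos2[of _ "{}"]) auto
qed

text \<open>
  Only the law of \<open>S\<close> enters, and this law is supported on the finitely many subsets of the index range.
\<close>

lemma integral_of_dpp_sample:
  fixes f :: "nat set \<Rightarrow> real"
  assumes A: "positive_semidefinite A"
    and S: "S \<in> measurable P (count_space UNIV)"
    and law: "distr P (count_space UNIV) S = measure_pmf (dpp A)"
  shows "(\<integral>\<omega>. f (S \<omega>) \<partial>P) = (\<Sum>T\<in>Pow {..<dim_row A}. f T * pmf (dpp A) T)"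
proof -
  have "(\<integral>\<omega>. f (S \<omega>) \<partial>P) = (\<integral>T. f T \<partial>measure_pmf (dpp A))"
    using integral_distr[OF S, of f] by (simp add: law)
  also have "\<dots> = (\<Sum>T\<in>Pow {..<dim_row A}. f T * pmf (dpp A) T)"
    by (rule integral_measure_pmf_real) (auto simp: set_pmf_eq pmf_dpp[OF A] split: if_splits)
  finally show ?thesis .
qed

section \<open>The expected pseudoinverse\<close>

theorem theorem1:
  fixes M :: "real mat" and d :: nat and \<alpha> :: real
    and P :: "'w measure" and S :: "'w \<Rightarrow> nat set"
  assumes "M \<in> carrier_mat d d"
    and "positive_definite M"
    and "\<alpha> > 0"
    and "prob_space P"
    and "S \<in> measurable P (count_space UNIV)"
    and "distr P (count_space UNIV) S = measure_pmf (dpp ((1 / \<alpha>) \<cdot>\<^sub>m M))"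
  shows "mat_inverse ((\<alpha> \<cdot>\<^sub>m 1\<^sub>m d) + M) =
           Some (mat_expectation d d P (\<lambda>\<omega>. pseudoinverse (restrict_mat M (S \<omega>))))"
proof -
  note M = assms(1) and pd = assms(2) and \<alpha> = assms(3)
  let ?A = "(1 / \<alpha>) \<cdot>\<^sub>m M"
  let ?B = "(\<alpha> \<cdot>\<^sub>m 1\<^sub>m d) + M"
  let ?E = "mat_expectation d d P (\<lambda>\<omega>. pseudoinverse (restrict_mat M (S \<omega>)))"
  have B: "?B \<in> carrier_mat d d" using M by simp
  have detB: "Determinant.det ?B > 0" by (rule det_shifted_pos[OF M pd \<alpha>])
  obtain C where C: "C \<in> carrier_mat d d" "?B * C = 1\<^sub>m d" "mat_inverse ?B = Some C"
    using obtain_mat_inverse[OF B] detB by (metis less_irrefl)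
  have psd: "positive_semidefinite ?A" using positive_definite_imp_semidefinite_smult[OF pd] \<alpha> by simp
  have "C = ?E"
  proof (rule eq_matI)
    fix i j assume "i < dim_row ?E" "j < dim_col ?E"
    then have ij: "i < d" "j < d" by (simp_all add: mat_expectation_def)
    have "?E $$ (i, j) = (\<integral>\<omega>. pseudoinverse (restrict_mat M (S \<omega>)) $$ (i, j) \<partial>P)"
      using ij by (simp add: mat_expectation_def)
    also have "\<dots> = (\<Sum>T\<in>Pow {..<d}. pseudoinverse (restrict_mat M T) $$ (i, j) * pmf (dpp ?A) T)"
      using integral_of_dpp_sample[OF psd assms(5,6), of "\<lambda>T. pseudoinverse (restrict_mat M T) $$ (i, j)"] M
      by simp
    also have "\<dots> = (\<Sum>T\<in>Pow {..<d}. \<alpha> ^ (d - card T) *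
        (principal_minor M T * pseudoinverse (restrict_mat M T) $$ (i, j))) / Determinant.det ?B"
      unfolding sum_divide_distrib
      by (intro sum.cong refl) (simp add: pmf_dpp_scaled[OF M pd \<alpha>])
    also have "\<dots> = (\<Sum>T\<in>Pow {..<d}. \<alpha> ^ (d - card T) *
        (if i \<in> T then Determinant.det (replace_col (cols_or_unit M T) (unit_vec d j) i) else 0))
        / Determinant.det ?B"
      by (intro arg_cong2[where f = "(/)"] sum.cong refl)
        (simp add: principal_minor_times_pseudoinverse[OF M _ det_cols_or_unit_nonzero[OF M pd] ij])
    also have "\<dots> = Determinant.det (replace_col ?B (unit_vec d j) i) / Determinant.det ?B"
      by (simp only: det_shifted_replace_col[OF M ij])
    also have "\<dots> = C $$ (i, j)"
      using inverse_entry_cramer[OF B C(1,2) ij] detB by (simp add: field_simps)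
    finally show "C $$ (i, j) = ?E $$ (i, j)" by simp
  qed (use C in \<open>auto simp: mat_expectation_def\<close>)
  with C(3) show ?thesis by simp
qed

end
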